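(* Let $d\ge 1$ and let $\Phi:\mathbb R^d\times M\to M$ be a continuous $\mathbb R^d$-action on a compact Riemannian manifold $M$. If there exists $v\in\mathbb R^d$ such that $(\Phi_{tv})_{t\in\mathbb R}$ is a Komuro-expansive flow, then the orbits of $\Phi$ are one-dimensional and coincide with the orbits of a flow.
   Context: A continuous $\mathbb R^d$-action is a continuous map $\Phi:\mathbb R^d\times M\to M$ such that, with $\Phi_v:=\Phi(v,\cdot)$, each $\Phi_v$ is a homeomorphism and $\Phi_{v+u}=\Phi_v\circ\Phi_u$ for all $u,v\in\mathbb R^d$. A continuous flow $\varphi$ on $M$ (with distance $\mathrm{dist}$) is Komuro-expansive (the paper simply says expansive) if for every $\varepsilon>0$ there is $\delta>0$ such that: if $x,y\in M$ and $\mathrm{dist}(\varphi_t(x),\varphi_{h(t)}(y))<\delta$ for every $t\in\mathbb R$ for some increasing homeomorphism $h:\mathbb R\to\mathbb R$, then there is $t_0\in\mathbb R$ with $\varphi_{h(t_0)}(y)\in\{\varphi_t(x): t\in[t_0-\varepsilon,t_0+\varepsilon]\}$.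
   Formalization: M has dimension at least 1, and one-dimensionality is claimed only for orbits that are not a single point: the circle flow with one source and one sink is Komuro-expansive, yet its fixed points have zero-dimensional orbits. *)

theory Defs
  imports "HOL-Analysis.Analysis"
begin

section \<open>Smooth manifolds and Riemannian metrics\<close>

text \<open>C^k and smooth maps on open subsets of a normed space, by iterated directional derivatives
  (every C^k map between finite-dimensional spaces is obtained in this way).\<close>

primrec Ck_on :: "nat \<Rightarrow> 'a::real_normed_vector set \<Rightarrow> ('a \<Rightarrow> 'b::real_normed_vector) \<Rightarrow> bool" where
  "Ck_on 0 S f \<longleftrightarrow> continuous_on S f"
| "Ck_on (Suc k) S f \<longleftrightarrow>
     (\<forall>x\<in>S. f differentiable (at x)) \<and> (\<forall>v. Ck_on k S (\<lambda>x. frechet_derivative f (at x) v))"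

definition smooth_on :: "'a::real_normed_vector set \<Rightarrow> ('a \<Rightarrow> 'b::real_normed_vector) \<Rightarrow> bool" where
  "smooth_on S f \<longleftrightarrow> (\<forall>k. Ck_on k S f)"

text \<open>A chart is its domain together with its coordinate map; the values of the coordinate map off
  the domain are irrelevant. The manifold is the whole type \<open>'m\<close>, of dimension \<open>CARD('n)\<close>.\<close>

type_synonym ('m, 'n) chart = "'m set \<times> ('m \<Rightarrow> real ^ 'n)"

definition transition :: "('m, 'n::finite) chart \<Rightarrow> ('m, 'n) chart \<Rightarrow> real ^ 'n \<Rightarrow> real ^ 'n" where
  "transition = (\<lambda>(U, c) (V, d). d \<circ> inv_into U c)"

definition smooth_atlas :: "('m::topological_space, 'n::finite) chart set \<Rightarrow> bool" where
  "smooth_atlas A \<longleftrightarrow>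
     (\<forall>(U, c)\<in>A. open U \<and> open (c ` U) \<and> homeomorphism U (c ` U) c (inv_into U c)) \<and>
     (\<Union>(U, c)\<in>A. U) = UNIV \<and>
     (\<forall>(U, c)\<in>A. \<forall>(V, d)\<in>A. smooth_on (c ` (U \<inter> V)) (transition (U, c) (V, d)))"

text \<open>A Riemannian metric in local coordinates: for a chart \<open>(U, c)\<close> and \<open>p\<close> in \<open>c ` U\<close>,
  \<open>g (U, c) p\<close> is the inner product on the tangent space at the point with coordinates \<open>p\<close>,
  tangent vectors being written in the coordinates \<open>c\<close>. The last clause says that the local
  expressions describe the same tensor, i.e. that transition maps are isometries.\<close>

definition riemannian_metric ::
  "('m::topological_space, 'n::finite) chart set \<Rightarrow>
   (('m, 'n) chart \<Rightarrow> real ^ 'n \<Rightarrow> real ^ 'n \<Rightarrow> real ^ 'n \<Rightarrow> real) \<Rightarrow> bool" where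
  "riemannian_metric A g \<longleftrightarrow>
     (\<forall>(U, c)\<in>A.
        (\<forall>p\<in>c ` U. bilinear (g (U, c) p) \<and>
           (\<forall>u w. g (U, c) p u w = g (U, c) p w u) \<and>
           (\<forall>u. u \<noteq> 0 \<longrightarrow> g (U, c) p u u > 0)) \<and>
        (\<forall>u w. smooth_on (c ` U) (\<lambda>p. g (U, c) p u w))) \<and>
     (\<forall>(U, c)\<in>A. \<forall>(V, d)\<in>A. \<forall>p\<in>c ` (U \<inter> V). \<forall>u w.
        let \<tau> = transition (U, c) (V, d); D = frechet_derivative \<tau> (at p)
        in g (U, c) p u w = g (V, d) (\<tau> p) (D u) (D w))"

definition piecewise_C1_curve ::
  "('m::topological_space, 'n::finite) chart set \<Rightarrow> (real \<Rightarrow> 'm) \<Rightarrow> bool" where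
  "piecewise_C1_curve A \<gamma> \<longleftrightarrow> path \<gamma> \<and>
     (\<forall>(U, c)\<in>A. \<forall>a b. {a..b} \<subseteq> {0..1} \<and> \<gamma> ` {a..b} \<subseteq> U
        \<longrightarrow> (c \<circ> \<gamma>) piecewise_C1_differentiable_on {a..b})"

definition chart_at :: "('m, 'n::finite) chart set \<Rightarrow> 'm \<Rightarrow> ('m, 'n) chart" where
  "chart_at A x = (SOME C. C \<in> A \<and> x \<in> fst C)"

text \<open>The Riemannian norm of the velocity; by the compatibility clause of
  \<open>riemannian_metric\<close> it does not depend on the chart chosen by \<open>chart_at\<close>.\<close>

definition speed ::
  "('m, 'n::finite) chart set \<Rightarrow>
   (('m, 'n) chart \<Rightarrow> real ^ 'n \<Rightarrow> real ^ 'n \<Rightarrow> real ^ 'n \<Rightarrow> real) \<Rightarrow> (real \<Rightarrow> 'm) \<Rightarrow> real \<Rightarrow> real" where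
  "speed A g \<gamma> t =
     (let C = chart_at A (\<gamma> t); w = vector_derivative (snd C \<circ> \<gamma>) (at t)
      in sqrt (g C (snd C (\<gamma> t)) w w))"

definition curve_length ::
  "('m, 'n::finite) chart set \<Rightarrow>
   (('m, 'n) chart \<Rightarrow> real ^ 'n \<Rightarrow> real ^ 'n \<Rightarrow> real ^ 'n \<Rightarrow> real) \<Rightarrow> (real \<Rightarrow> 'm) \<Rightarrow> ennreal" where
  "curve_length A g \<gamma> = (\<integral>\<^sup>+ t\<in>{0..1}. ennreal (speed A g \<gamma> t) \<partial>lborel)"

text \<open>The manifold is not assumed connected; points in different components have distance \<open>\<infinity>\<close>.
  The library's piecewise C^1 functions may have unbounded derivative near a breakpoint. The
  length, being a nonnegative Lebesgue integral, is then still meaningful (possibly \<open>\<infinity>\<close>), and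
  allowing such curves does not change the infimum.\<close>

definition riemannian_dist ::
  "('m::topological_space, 'n::finite) chart set \<Rightarrow>
   (('m, 'n) chart \<Rightarrow> real ^ 'n \<Rightarrow> real ^ 'n \<Rightarrow> real ^ 'n \<Rightarrow> real) \<Rightarrow> 'm \<Rightarrow> 'm \<Rightarrow> ennreal" where
  "riemannian_dist A g x y =
     (INF \<gamma>\<in>{\<gamma>. piecewise_C1_curve A \<gamma> \<and> pathstart \<gamma> = x \<and> pathfinish \<gamma> = y}. curve_length A g \<gamma>)"

section \<open>Actions, flows and expansiveness\<close>

text \<open>With \<open>'v = real ^ 'd\<close> these are the continuous actions of the d-dimensional vector group;
  with \<open>'v = real\<close> they are the continuous flows.\<close>

definition continuous_action :: "('v::real_normed_vector \<Rightarrow> 'm::topological_space \<Rightarrow> 'm) \<Rightarrow> bool" where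
  "continuous_action \<Phi> \<longleftrightarrow>
     continuous_on UNIV (\<lambda>(v, x). \<Phi> v x) \<and>
     (\<forall>v. homeomorphism UNIV UNIV (\<Phi> v) (inv (\<Phi> v))) \<and>
     (\<forall>v u. \<Phi> (v + u) = \<Phi> v \<circ> \<Phi> u)"

abbreviation continuous_flow :: "(real \<Rightarrow> 'm::topological_space \<Rightarrow> 'm) \<Rightarrow> bool" where
  "continuous_flow \<equiv> continuous_action"

definition action_orbit :: "('v \<Rightarrow> 'm \<Rightarrow> 'm) \<Rightarrow> 'm \<Rightarrow> 'm set" where
  "action_orbit \<Phi> x = range (\<lambda>v. \<Phi> v x)"

definition increasing_homeo :: "(real \<Rightarrow> real) \<Rightarrow> bool" where
  "increasing_homeo h \<longleftrightarrow> strict_mono h \<and> homeomorphism UNIV UNIV h (inv h)"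

definition komuro_expansive ::
  "('m::topological_space \<Rightarrow> 'm \<Rightarrow> ennreal) \<Rightarrow> (real \<Rightarrow> 'm \<Rightarrow> 'm) \<Rightarrow> bool" where
  "komuro_expansive D \<phi> \<longleftrightarrow> continuous_flow \<phi> \<and>
     (\<forall>\<epsilon>>0. \<exists>\<delta>>0. \<forall>x y h.
        increasing_homeo h \<and> (\<forall>t. D (\<phi> t x) (\<phi> (h t) y) < ennreal \<delta>) \<longrightarrow>
        (\<exists>t0. \<phi> (h t0) y \<in> {\<phi> t x | t. t \<in> {t0 - \<epsilon>..t0 + \<epsilon>}}))"

section \<open>Dimension of orbits\<close>

text \<open>An orbit is given its intrinsic (leaf) topology, the quotient topology under the orbit map.
  It is in general finer than the subspace topology, in which, for instance, a dense line in a
  torus is not a manifold.\<close>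

definition orbit_topology :: "('v::real_normed_vector \<Rightarrow> 'm \<Rightarrow> 'm) \<Rightarrow> 'm \<Rightarrow> 'm topology" where
  "orbit_topology \<Phi> x = topology (\<lambda>W. W \<subseteq> action_orbit \<Phi> x \<and> open {v. \<Phi> v x \<in> W})"

lemma openin_orbit_topology:
  "openin (orbit_topology \<Phi> x) W \<longleftrightarrow> W \<subseteq> action_orbit \<Phi> x \<and> open {v. \<Phi> v x \<in> W}"
proof -
  have "istopology (\<lambda>W. W \<subseteq> action_orbit \<Phi> x \<and> open {v. \<Phi> v x \<in> W})"
    unfolding istopology_def
  proof (intro conjI allI impI)
    fix S T
    assume "S \<subseteq> action_orbit \<Phi> x \<and> open {v. \<Phi> v x \<in> S}"
      and "T \<subseteq> action_orbit \<Phi> x \<and> open {v. \<Phi> v x \<in> T}"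
    moreover have "{v. \<Phi> v x \<in> S \<inter> T} = {v. \<Phi> v x \<in> S} \<inter> {v. \<Phi> v x \<in> T}" by auto
    ultimately show "S \<inter> T \<subseteq> action_orbit \<Phi> x" "open {v. \<Phi> v x \<in> S \<inter> T}" by auto
  next
    fix K
    assume K: "\<forall>S\<in>K. S \<subseteq> action_orbit \<Phi> x \<and> open {v. \<Phi> v x \<in> S}"
    have "{v. \<Phi> v x \<in> \<Union>K} = (\<Union>S\<in>K. {v. \<Phi> v x \<in> S})" by auto
    with K show "open {v. \<Phi> v x \<in> \<Union>K}" by auto
    from K show "\<Union>K \<subseteq> action_orbit \<Phi> x" by auto
  qed
  then show ?thesis by (simp add: orbit_topology_def topology_inverse')
qed

lemma quotient_map_orbit_topology:
  "quotient_map euclidean (orbit_topology \<Phi> x) (\<lambda>v. \<Phi> v x)"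
proof -
  have "openin (orbit_topology \<Phi> x) (action_orbit \<Phi> x)"
    by (simp add: openin_orbit_topology action_orbit_def)
  then have "topspace (orbit_topology \<Phi> x) = action_orbit \<Phi> x"
    by (meson openin_orbit_topology openin_subset openin_topspace subset_antisym)
  then show ?thesis
    by (auto simp: quotient_map_def openin_orbit_topology action_orbit_def)
qed

definition topological_manifold :: "nat \<Rightarrow> 'a topology \<Rightarrow> bool" where
  "topological_manifold n X \<longleftrightarrow> Hausdorff_space X \<and> second_countable X \<and>
     (\<forall>x\<in>topspace X. \<exists>U V. openin X U \<and> x \<in> U \<and> openin (Euclidean_space n) V \<and>
        subtopology X U homeomorphic_space subtopology (Euclidean_space n) V)"

end

theory Submission
  imports Defs
begin

text \<open>
  Write \<open>\<phi>\<close> for the expansive flow \<open>t \<mapsto> \<Phi> (t *\<^sub>R v)\<close>. The group acting is abelian, so every \<open>\<Phi> u\<close>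
  commutes with \<open>\<phi>\<close>: the \<open>\<phi>\<close>-orbit of \<open>\<Phi> u x\<close> is the image under \<open>\<Phi> u\<close> of the \<open>\<phi>\<close>-orbit of \<open>x\<close>.
  If \<open>u\<close> is small, then \<open>\<Phi> u\<close> is uniformly close to the identity, and the two orbits shadow each
  other without any reparametrization. Expansiveness puts them on the same \<open>\<phi>\<close>-orbit, with a small
  time shift: for every \<open>\<epsilon> > 0\<close>, all sufficiently small \<open>u\<close> satisfy
  \<open>\<Phi> u x = \<Phi> (s *\<^sub>R v) x\<close> with \<open>\<bar>s\<bar> \<le> \<epsilon>\<close> depending on \<open>u\<close> and \<open>x\<close>
  (\<open>expansive_line_absorbs_small_vectors\<close>).

  Dividing an arbitrary vector into many small ones shows that the orbits of \<open>\<Phi>\<close> are the orbits of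
  \<open>\<phi>\<close>. The bound on the time shift gives more, namely that the leaf topology an orbit
  receives from \<open>\<Phi>\<close> is the one it receives from \<open>\<phi>\<close>
  (\<open>orbit_topology_eq_line_orbit_topology\<close>). The dimension of the orbits is therefore a matter of
  flows alone: the times fixing a point form a closed subgroup of the line, which for an orbit other
  than a point is discrete, and the orbit is a quotient of the line by it, hence a 1-manifold
  (\<open>topological_manifold_flow_orbit\<close>).

  Uniform closeness has to be measured in the Riemannian distance, whereas the action is only
  known to be continuous for the topology. Straight segments in a chart show that nearby points have
  small distance (\<open>riemannian_dist_locally_small\<close>), and compactness makes this uniform
  (\<open>small_displacement\<close>).
\<close>

section \<open>The Riemannian distance is small at small scales\<close>

lemma smooth_atlas_chartD:
  assumes "smooth_atlas A" "(U, c) \<in> A"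
  shows "open U" "open (c ` U)" "homeomorphism U (c ` U) c (inv_into U c)"
  using assms unfolding smooth_atlas_def by auto

lemma transition_C1:
  assumes "smooth_atlas A" "(U, c) \<in> A" "(V, d) \<in> A"
  defines "\<tau> \<equiv> transition (U, c) (V, d)"
  shows "p \<in> c ` (U \<inter> V) \<Longrightarrow> (\<tau> has_derivative frechet_derivative \<tau> (at p)) (at p)"
    and "continuous_on (c ` (U \<inter> V)) (\<lambda>p. frechet_derivative \<tau> (at p) w)"
proof -
  have "Ck_on (Suc 0) (c ` (U \<inter> V)) \<tau>"
    using assms unfolding smooth_atlas_def smooth_on_def by fast
  then show "p \<in> c ` (U \<inter> V) \<Longrightarrow> (\<tau> has_derivative frechet_derivative \<tau> (at p)) (at p)"
    and "continuous_on (c ` (U \<inter> V)) (\<lambda>p. frechet_derivative \<tau> (at p) w)"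
    using frechet_derivative_works by auto
qed

text \<open>The bound is the length of the curve that is a straight segment in the coordinates \<open>c\<close>. Both
  the smoothness condition on a curve and its speed refer to charts other than \<open>c\<close>, so the velocity
  is computed in an arbitrary chart, as the image of the constant vector \<open>w\<close> under the derivative of
  a transition map; the metric being a tensor, its norm is that of \<open>w\<close> at the point \<open>l t\<close>.\<close>
lemma riemannian_dist_le_coordinate_dist:
  fixes A :: "('m::topological_space, 'n::finite) chart set"
  assumes A: "smooth_atlas A" and g: "riemannian_metric A g" and U: "(U, c) \<in> A"
    and B: "convex B" "B \<subseteq> c ` U" and K: "0 \<le> K"
    and bound: "\<And>p w. p \<in> B \<Longrightarrow> g (U, c) p w w \<le> (K * norm w)\<^sup>2"
    and x: "x \<in> U" "c x \<in> B" and y: "y \<in> U" "c y \<in> B"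
  shows "riemannian_dist A g x y \<le> ennreal (K * norm (c y - c x))"
proof -
  note ch = smooth_atlas_chartD[OF A U]
  define w where "w = c y - c x"
  define l where "l t = c x + t *\<^sub>R w" for t :: real
  define \<gamma> where "\<gamma> = inv_into U c \<circ> l"
  have l_B: "l t \<in> B" if "t \<in> {0..1}" for t
  proof -
    have "l t = (1 - t) *\<^sub>R c x + t *\<^sub>R c y" by (simp add: l_def w_def algebra_simps)
    then show ?thesis using convexD[OF B(1) x(2) y(2), of "1 - t" t] that by simp
  qed
  have \<gamma>_U: "\<gamma> t \<in> U" and c_\<gamma>: "c (\<gamma> t) = l t" if "t \<in> {0..1}" for t
    using l_B[OF that] B(2) by (auto simp: \<gamma>_def inv_into_into f_inv_into_f)
  have "inj_on c U" using ch(3) by (metis homeomorphism_def inj_on_inverseI)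
  then have ends: "\<gamma> 0 = x" "\<gamma> 1 = y" using x y by (auto simp: \<gamma>_def l_def w_def)
  have cont_l: "continuous_on S l" for S unfolding l_def by (intro continuous_intros)
  have path: "path \<gamma>"
    unfolding path_def \<gamma>_def
    using ch(3) l_B B(2) by (intro continuous_on_compose cont_l)
      (auto simp: homeomorphism_def elim!: continuous_on_subset)
  define F where "F V d t = frechet_derivative (transition (U, c) (V, d)) (at (l t)) w" for V d t
  have in_overlap: "l t \<in> c ` (U \<inter> V)" if "t \<in> {0..1}" "\<gamma> t \<in> V" for t V
    using \<gamma>_U[OF that(1)] c_\<gamma>[OF that(1)] that(2) by (metis IntI imageI)
  have velocity: "((d \<circ> \<gamma>) has_vector_derivative F V d t) (at t)"
    if "(V, d) \<in> A" "t \<in> {0..1}" "\<gamma> t \<in> V" for V d t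
  proof -
    \<comment> \<open>An equality of functions on the whole line, so the derivative is two-sided even at \<open>t = 0\<close>
      and \<open>t = 1\<close>.\<close>
    have *: "d \<circ> \<gamma> = transition (U, c) (V, d) \<circ> l"
      by (simp add: transition_def \<gamma>_def comp_assoc)
    have "(l has_derivative (\<lambda>s. s *\<^sub>R w)) (at t)"
      unfolding l_def by (auto intro!: derivative_eq_intros)
    from diff_chain_at[OF this transition_C1(1)[OF A U that(1) in_overlap[OF that(2,3)]]]
    have D: "((d \<circ> \<gamma>) has_derivative
        (frechet_derivative (transition (U, c) (V, d)) (at (l t)) \<circ> (\<lambda>s. s *\<^sub>R w))) (at t)"
      by (simp add: *)
    have "linear (frechet_derivative (transition (U, c) (V, d)) (at (l t)))"
      using transition_C1(1)[OF A U that(1) in_overlap[OF that(2,3)]] has_derivative_linear by blast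
    with D show ?thesis
      by (simp add: has_vector_derivative_def F_def linear_cmul o_def)
  qed
  have "(d \<circ> \<gamma>) piecewise_C1_differentiable_on {a..b}"
    if V: "(V, d) \<in> A" and ab: "{a..b} \<subseteq> {0..1}" "\<gamma> ` {a..b} \<subseteq> V" for V d a b
  proof (rule C1_differentiable_imp_piecewise)
    have "l ` {a..b} \<subseteq> c ` (U \<inter> V)" using in_overlap ab by blast
    then have "continuous_on {a..b} (F V d)"
      unfolding F_def by (rule continuous_on_compose2[OF transition_C1(2)[OF A U V] cont_l])
    then show "(d \<circ> \<gamma>) C1_differentiable_on {a..b}"
      unfolding C1_differentiable_on_def using velocity[OF V] ab by blast
  qed
  then have "piecewise_C1_curve A \<gamma>"
    unfolding piecewise_C1_curve_def using path by blast
  then have "riemannian_dist A g x y \<le> curve_length A g \<gamma>"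
    unfolding riemannian_dist_def using ends
    by (intro INF_lower) (auto simp: pathstart_def pathfinish_def)
  also have "curve_length A g \<gamma> \<le> (\<integral>\<^sup>+ t\<in>{0..1::real}. ennreal (K * norm w) \<partial>lborel)"
    unfolding curve_length_def
  proof (rule nn_integral_mono)
    fix t :: real
    have "speed A g \<gamma> t \<le> K * norm w" if t: "t \<in> {0..1}"
    proof -
      have "\<exists>C. C \<in> A \<and> \<gamma> t \<in> fst C"
        using U \<gamma>_U[OF t] by force
      then have "chart_at A (\<gamma> t) \<in> A \<and> \<gamma> t \<in> fst (chart_at A (\<gamma> t))"
        unfolding chart_at_def by (rule someI_ex)
      then obtain V d where V: "chart_at A (\<gamma> t) = (V, d)" "(V, d) \<in> A" "\<gamma> t \<in> V"
        by (metis prod.collapse)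
      have "g (U, c) (l t) w w = g (V, d) (transition (U, c) (V, d) (l t)) (F V d t) (F V d t)"
        using g U V(2) in_overlap[OF t V(3)]
        unfolding riemannian_metric_def F_def Let_def by fast
      moreover have "transition (U, c) (V, d) (l t) = d (\<gamma> t)"
        by (simp add: transition_def \<gamma>_def)
      ultimately have "speed A g \<gamma> t = sqrt (g (U, c) (l t) w w)"
        using velocity[OF V(2) t V(3)]
        by (simp add: speed_def V(1) Let_def vector_derivative_at)
      also have "\<dots> \<le> K * norm w"
        using bound[OF l_B[OF t]] K by (intro real_le_lsqrt) auto
      finally show ?thesis .
    qed
    then show "ennreal (speed A g \<gamma> t) * indicator {0..1} t \<le> ennreal (K * norm w) * indicator {0..1} t"
      by (auto simp: indicator_def intro: ennreal_leI)
  qed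
  also have "\<dots> = ennreal (K * norm (c y - c x))"
    by (simp add: nn_integral_cmult_indicator w_def)
  finally show ?thesis .
qed

text \<open>The entries of the Gram matrix are continuous, hence bounded on a compact set; the
  sum of their bounds is a bound for the quadratic form on unit vectors.\<close>
lemma metric_coefficients_bounded_on_compact:
  fixes A :: "('m::topological_space, 'n::finite) chart set"
  assumes g: "riemannian_metric A g" and U: "(U, c) \<in> A" and S: "compact S" "S \<subseteq> c ` U"
  obtains K where "0 \<le> K" "\<And>p w. p \<in> S \<Longrightarrow> g (U, c) p w w \<le> (K * norm w)\<^sup>2"
proof -
  have "\<exists>M. \<forall>p\<in>S. \<bar>g (U, c) p i j\<bar> \<le> M" for i j
  proof -
    have "smooth_on (c ` U) (\<lambda>p. g (U, c) p i j)"
      using g U unfolding riemannian_metric_def by fast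
    then have "Ck_on 0 (c ` U) (\<lambda>p. g (U, c) p i j)" unfolding smooth_on_def by blast
    then have "continuous_on S (\<lambda>p. g (U, c) p i j)"
      using S(2) continuous_on_subset by auto
    from compact_imp_bounded[OF compact_continuous_image[OF this S(1)]] show ?thesis
      by (auto simp: bounded_iff)
  qed
  then obtain M where M: "\<And>i j p. p \<in> S \<Longrightarrow> \<bar>g (U, c) p i j\<bar> \<le> M i j" by metis
  define Q where "Q = (\<Sum>(i, j)\<in>Basis \<times> Basis. \<bar>M i j\<bar>)"
  have Q: "0 \<le> Q" unfolding Q_def by (intro sum_nonneg) auto
  have "g (U, c) p w w \<le> (sqrt Q * norm w)\<^sup>2" if p: "p \<in> S" for p w
  proof -
    have bl: "bilinear (g (U, c) p)"
      using g U p S(2) unfolding riemannian_metric_def by fast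
    have "g (U, c) p w w = g (U, c) p (\<Sum>i\<in>Basis. (w \<bullet> i) *\<^sub>R i) (\<Sum>i\<in>Basis. (w \<bullet> i) *\<^sub>R i)"
      by (simp add: euclidean_representation)
    also have "\<dots> = (\<Sum>(i, j)\<in>Basis \<times> Basis. (w \<bullet> i) * ((w \<bullet> j) * g (U, c) p i j))"
      unfolding bilinear_sum[OF bl]
      by (simp add: bilinear_lmul[OF bl] bilinear_rmul[OF bl] mult.left_commute)
    also have "\<dots> \<le> (\<Sum>(i, j)\<in>Basis \<times> Basis. \<bar>M i j\<bar> * (norm w)\<^sup>2)"
    proof (rule sum_mono, clarify)
      fix i j :: "real ^ 'n" assume "i \<in> Basis" "j \<in> Basis"
      have "(w \<bullet> i) * ((w \<bullet> j) * g (U, c) p i j) \<le> \<bar>w \<bullet> i\<bar> * (\<bar>w \<bullet> j\<bar> * \<bar>g (U, c) p i j\<bar>)"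
        by (metis abs_ge_self abs_mult)
      also have "\<dots> \<le> norm w * (norm w * \<bar>M i j\<bar>)"
        using M[OF p, of i j] \<open>i \<in> Basis\<close> \<open>j \<in> Basis\<close> by (intro mult_mono) (auto simp: Basis_le_norm)
      also have "\<dots> = \<bar>M i j\<bar> * (norm w)\<^sup>2"
        by (simp add: power2_eq_square mult_ac)
      finally show "(w \<bullet> i) * ((w \<bullet> j) * g (U, c) p i j) \<le> \<bar>M i j\<bar> * (norm w)\<^sup>2" .
    qed
    also have "\<dots> = (sqrt Q * norm w)\<^sup>2"
      using Q by (simp add: Q_def power_mult_distrib sum_distrib_right case_prod_beta)
    finally show ?thesis .
  qed
  then show ?thesis using that[of "sqrt Q"] Q by simp
qed

text \<open>In a coordinate ball around \<open>z\<close> with compact closure in the chart, the metric is bounded by a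
  multiple of the Euclidean one, so shrinking the ball makes all distances in it small.\<close>
lemma riemannian_dist_locally_small:
  fixes A :: "('m::topological_space, 'n::finite) chart set"
  assumes A: "smooth_atlas A" and g: "riemannian_metric A g" and \<delta>: "0 < \<delta>"
  obtains N where "open N" "z \<in> N" "\<And>x y. x \<in> N \<Longrightarrow> y \<in> N \<Longrightarrow> riemannian_dist A g x y < ennreal \<delta>"
proof -
  obtain U c where U: "(U, c) \<in> A" "z \<in> U"
    using A unfolding smooth_atlas_def by blast
  note ch = smooth_atlas_chartD[OF A U(1)]
  obtain r where r: "0 < r" "cball (c z) r \<subseteq> c ` U"
    using ch(2) U(2) open_contains_cball by blast
  obtain K where K: "0 \<le> K" "\<And>p w. p \<in> cball (c z) r \<Longrightarrow> g (U, c) p w w \<le> (K * norm w)\<^sup>2"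
    using metric_coefficients_bounded_on_compact[OF g U(1) compact_cball r(2)] by blast
  \<comment> \<open>\<open>K + 1\<close> instead of \<open>K\<close> keeps the denominator positive when \<open>K = 0\<close>.\<close>
  define s where "s = min r (\<delta> / (2 * (K + 1)))"
  have s: "0 < s" using r(1) \<delta> K(1) by (simp add: s_def)
  define N where "N = U \<inter> c -` ball (c z) s"
  have "riemannian_dist A g x y < ennreal \<delta>" if "x \<in> N" "y \<in> N" for x y
  proof -
    have "dist (c z) (c x) < s" "dist (c z) (c y) < s"
      using that by (auto simp: N_def)
    then have xy: "norm (c y - c x) < 2 * s" "c x \<in> cball (c z) r" "c y \<in> cball (c z) r"
      using norm_triangle_ineq4[of "c y - c z" "c x - c z"]
      by (auto simp: s_def dist_norm norm_minus_commute)
    have "K * norm (c y - c x) \<le> K * (2 * s)"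
      using xy(1) K(1) by (intro mult_left_mono) auto
    also have "\<dots> < (K + 1) * (2 * s)" using s by simp
    also have "\<dots> \<le> (K + 1) * (2 * (\<delta> / (2 * (K + 1))))"
      using K(1) by (intro mult_left_mono) (auto simp: s_def)
    also have "\<dots> = \<delta>" using K(1) by (simp add: field_simps)
    finally have "ennreal (K * norm (c y - c x)) < ennreal \<delta>"
      using \<delta> K(1) by (simp add: ennreal_less_iff)
    moreover have "riemannian_dist A g x y \<le> ennreal (K * norm (c y - c x))"
      using that xy K r(2)
      by (intro riemannian_dist_le_coordinate_dist[OF A g U(1), of "cball (c z) r"]) (auto simp: N_def)
    ultimately show ?thesis by order
  qed
  moreover have "open N"
    using ch(1,3) unfolding N_def
    by (intro continuous_open_preimage) (auto simp: homeomorphism_def)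
  moreover have "z \<in> N" using U(2) s by (simp add: N_def)
  ultimately show ?thesis using that by blast
qed

section \<open>Continuous actions\<close>

lemma continuous_action_add: "continuous_action \<Phi> \<Longrightarrow> \<Phi> (v + u) x = \<Phi> v (\<Phi> u x)"
  by (simp add: continuous_action_def)

lemma continuous_action_zero:
  assumes "continuous_action \<Phi>"
  shows "\<Phi> 0 x = x"
proof -
  have "\<Phi> 0 (\<Phi> 0 x) = \<Phi> 0 x" using continuous_action_add[OF assms, of 0 0 x] by simp
  moreover have "inj (\<Phi> 0)"
    using assms unfolding continuous_action_def by (metis homeomorphism_def inj_on_inverseI)
  ultimately show ?thesis by (simp add: inj_eq)
qed

lemma continuous_on_action:
  assumes "continuous_action \<Phi>" "continuous_on S f" "continuous_on S h"
  shows "continuous_on S (\<lambda>z. \<Phi> (f z) (h z))"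
proof -
  have "continuous_on UNIV (\<lambda>p. \<Phi> (fst p) (snd p))"
    using assms(1) by (simp add: continuous_action_def case_prod_beta)
  from continuous_on_compose2[OF this continuous_on_Pair[OF assms(2,3)]] show ?thesis by simp
qed

lemma continuous_action_line:
  assumes "continuous_action \<Phi>"
  shows "continuous_flow (\<lambda>t. \<Phi> (t *\<^sub>R v))"
  unfolding continuous_action_def
proof (intro conjI allI)
  show "continuous_on UNIV (\<lambda>(t, x). \<Phi> (t *\<^sub>R v) x)"
    unfolding case_prod_beta by (intro continuous_on_action[OF assms] continuous_intros)
  show "homeomorphism UNIV UNIV (\<Phi> (t *\<^sub>R v)) (inv (\<Phi> (t *\<^sub>R v)))" for t
    using assms by (simp add: continuous_action_def)
  show "\<Phi> ((t + s) *\<^sub>R v) = \<Phi> (t *\<^sub>R v) \<circ> \<Phi> (s *\<^sub>R v)" for t s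
    using assms by (simp add: continuous_action_def scaleR_add_left)
qed

text \<open>The pairs \<open>(u, y)\<close> for which \<open>y\<close> and \<open>\<Phi> u y\<close> lie in a common neighbourhood of small diameter
  form an open set containing \<open>{0} \<times> UNIV\<close>; by compactness it contains a tube around that set.\<close>
lemma small_displacement:
  fixes \<Phi> :: "'v::real_normed_vector \<Rightarrow> 'm::topological_space \<Rightarrow> 'm"
  assumes "compact (UNIV :: 'm set)" "smooth_atlas A" "riemannian_metric A g"
    and \<Phi>: "continuous_action \<Phi>" and \<delta>: "0 < \<delta>"
  obtains \<eta> where "0 < \<eta>" "\<And>u y. norm u < \<eta> \<Longrightarrow> riemannian_dist A g y (\<Phi> u y) < ennreal \<delta>"
proof -
  have "\<exists>N. open N \<and> z \<in> N \<and> (\<forall>x\<in>N. \<forall>y\<in>N. riemannian_dist A g x y < ennreal \<delta>)" for z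
    using riemannian_dist_locally_small[OF assms(2,3) \<delta>, of z] by metis
  then obtain N where N: "\<And>z. open (N z)" "\<And>z. z \<in> N z"
      "\<And>z x y. x \<in> N z \<Longrightarrow> y \<in> N z \<Longrightarrow> riemannian_dist A g x y < ennreal \<delta>"
    by metis
  define W where "W = (\<lambda>(u, y). (y, \<Phi> u y)) -` (\<Union>z. N z \<times> N z)"
  have "continuous_on UNIV (\<lambda>(u, y). (y, \<Phi> u y))"
    unfolding case_prod_beta by (intro continuous_on_Pair continuous_on_action[OF \<Phi>] continuous_intros)
  then have "open W"
    unfolding W_def using N(1) by (intro open_vimage) (auto intro: open_Times)
  moreover have "{0} \<times> UNIV \<subseteq> W"
  proof clarify
    fix y show "(0, y) \<in> W"
      using N(2)[of y] by (auto simp: W_def continuous_action_zero[OF \<Phi>])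
  qed
  ultimately obtain X where X: "0 \<in> X" "open X" "X \<times> UNIV \<subseteq> W"
    using Elementary_Topology.tube_lemma[OF assms(1), of W 0] by auto
  then obtain \<eta> where \<eta>: "0 < \<eta>" "ball 0 \<eta> \<subseteq> X" using open_contains_ball by blast
  have "riemannian_dist A g y (\<Phi> u y) < ennreal \<delta>" if "norm u < \<eta>" for u y
  proof -
    have "u \<in> X" using that \<eta>(2) by (simp add: subset_iff)
    then have "(u, y) \<in> W" using X(3) by blast
    then show ?thesis using N(3) by (auto simp: W_def)
  qed
  with \<eta>(1) that show ?thesis by blast
qed

text \<open>The heart of the argument: a small vector moves each point along its orbit under the expansive
  line, and only for a short time. Commutativity makes the orbits of \<open>x\<close> and \<open>\<Phi> u x\<close> shadow each
  other at equal times, so expansiveness applies with the identity as reparametrization.\<close>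
lemma expansive_line_absorbs_small_vectors:
  fixes \<Phi> :: "'v::real_normed_vector \<Rightarrow> 'm::topological_space \<Rightarrow> 'm"
  assumes "compact (UNIV :: 'm set)" "smooth_atlas A" "riemannian_metric A g"
    and \<Phi>: "continuous_action \<Phi>"
    and exp: "komuro_expansive (riemannian_dist A g) (\<lambda>t. \<Phi> (t *\<^sub>R v))" and "0 < \<epsilon>"
  obtains \<eta> where "0 < \<eta>" "\<And>u x. norm u < \<eta> \<Longrightarrow> \<exists>s. \<bar>s\<bar> \<le> \<epsilon> \<and> \<Phi> u x = \<Phi> (s *\<^sub>R v) x"
proof -
  obtain \<delta> where \<delta>: "0 < \<delta>" and shadow: "\<forall>x y h. increasing_homeo h \<and>
      (\<forall>t. riemannian_dist A g (\<Phi> (t *\<^sub>R v) x) (\<Phi> (h t *\<^sub>R v) y) < ennreal \<delta>) \<longrightarrow>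
      (\<exists>t0. \<Phi> (h t0 *\<^sub>R v) y \<in> {\<Phi> (t *\<^sub>R v) x | t. t \<in> {t0 - \<epsilon>..t0 + \<epsilon>}})"
    using exp[unfolded komuro_expansive_def, THEN conjunct2, rule_format, OF \<open>0 < \<epsilon>\<close>] by auto
  obtain \<eta> where \<eta>: "0 < \<eta>"
      "\<And>u y. norm u < \<eta> \<Longrightarrow> riemannian_dist A g y (\<Phi> u y) < ennreal \<delta>"
    using small_displacement[OF assms(1-3) \<Phi> \<delta>] by blast
  have "\<exists>s. \<bar>s\<bar> \<le> \<epsilon> \<and> \<Phi> u x = \<Phi> (s *\<^sub>R v) x" if u: "norm u < \<eta>" for u x
  proof -
    have id: "increasing_homeo id"
      by (auto simp: increasing_homeo_def strict_mono_def homeomorphism_def)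
    have commute: "\<Phi> (t *\<^sub>R v) (\<Phi> u x) = \<Phi> u (\<Phi> (t *\<^sub>R v) x)" for t
      by (metis add.commute continuous_action_add[OF \<Phi>])
    have "\<forall>t. riemannian_dist A g (\<Phi> (t *\<^sub>R v) x) (\<Phi> (id t *\<^sub>R v) (\<Phi> u x)) < ennreal \<delta>"
      using \<eta>(2)[OF u] by (simp add: commute)
    then have "\<exists>t0. \<Phi> (id t0 *\<^sub>R v) (\<Phi> u x) \<in> {\<Phi> (t *\<^sub>R v) x | t. t \<in> {t0 - \<epsilon>..t0 + \<epsilon>}}"
      by (rule shadow[rule_format, OF conjI[OF id]])
    then obtain t0 t where t: "\<Phi> (t0 *\<^sub>R v) (\<Phi> u x) = \<Phi> (t *\<^sub>R v) x" "t \<in> {t0 - \<epsilon>..t0 + \<epsilon>}"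
      by auto
    have "\<Phi> u x = \<Phi> ((-t0) *\<^sub>R v) (\<Phi> (t0 *\<^sub>R v) (\<Phi> u x))"
      by (simp flip: continuous_action_add[OF \<Phi>])
    also have "\<dots> = \<Phi> ((t - t0) *\<^sub>R v) x"
      unfolding t(1) by (simp add: scaleR_diff_left flip: continuous_action_add[OF \<Phi>])
    finally show ?thesis using t(2) by (intro exI[of _ "t - t0"]) auto
  qed
  with \<eta>(1) that show ?thesis by blast
qed

section \<open>Orbits of the action and orbits of the line\<close>

text \<open>The size of \<open>\<eta>\<close> does not depend on the point, so a large vector can be traversed in
  \<open>n\<close> equal steps shorter than \<open>\<eta>\<close>, each of which stays on the orbit of the line.\<close>
lemma orbit_eq_line_orbit:
  fixes \<Phi> :: "'v::real_normed_vector \<Rightarrow> 'm::topological_space \<Rightarrow> 'm"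
  assumes \<Phi>: "continuous_action \<Phi>" and "0 < \<eta>"
    and absorb: "\<And>u x. norm u < \<eta> \<Longrightarrow> \<exists>s. \<Phi> u x = \<Phi> (s *\<^sub>R v) x"
  shows "action_orbit \<Phi> x = action_orbit (\<lambda>t. \<Phi> (t *\<^sub>R v)) x"
proof -
  have "\<exists>s. \<Phi> (of_nat n *\<^sub>R u) x = \<Phi> (s *\<^sub>R v) x" if u: "norm u < \<eta>" for n u
  proof (induction n)
    case 0
    show ?case by (rule exI[of _ 0]) simp
  next
    case (Suc n)
    then obtain s where s: "\<Phi> (of_nat n *\<^sub>R u) x = \<Phi> (s *\<^sub>R v) x" by blast
    obtain s' where s': "\<Phi> u (\<Phi> (s *\<^sub>R v) x) = \<Phi> (s' *\<^sub>R v) (\<Phi> (s *\<^sub>R v) x)"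
      using absorb[OF u] by blast
    have "\<Phi> (of_nat (Suc n) *\<^sub>R u) x = \<Phi> u (\<Phi> (of_nat n *\<^sub>R u) x)"
      by (simp add: algebra_simps flip: continuous_action_add[OF \<Phi>])
    also have "\<dots> = \<Phi> ((s' + s) *\<^sub>R v) x"
      unfolding s s' by (simp add: scaleR_add_left flip: continuous_action_add[OF \<Phi>])
    finally show ?case by blast
  qed
  note multiples = this
  have "\<exists>s. \<Phi> w x = \<Phi> (s *\<^sub>R v) x" for w
  proof -
    obtain n :: nat where n: "norm w / \<eta> < real n" using reals_Archimedean2 by blast
    then have n0: "0 < n" using \<open>0 < \<eta>\<close>
      by (metis divide_nonneg_pos linorder_not_less norm_ge_zero of_nat_0_less_iff order_le_less_trans)
    then have "norm (w /\<^sub>R real n) < \<eta>"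
      using n \<open>0 < \<eta>\<close> by (simp add: field_simps)
    from multiples[OF this, of n] n0 show ?thesis by simp
  qed
  then show ?thesis by (auto simp: action_orbit_def image_def)
qed

text \<open>Vectors tending to \<open>0\<close> are absorbed by times tending to \<open>0\<close>, uniformly in the point. Thus a
  set that contains \<open>\<Phi> (t *\<^sub>R v) x\<close> for all times \<open>t\<close> near \<open>s\<close> also contains \<open>\<Phi> u' x\<close> for all \<open>u'\<close>
  near any \<open>u\<close> with \<open>\<Phi> u x = \<Phi> (s *\<^sub>R v) x\<close>.\<close>
lemma orbit_topology_eq_line_orbit_topology:
  fixes \<Phi> :: "'v::real_normed_vector \<Rightarrow> 'm::topological_space \<Rightarrow> 'm"
  assumes \<Phi>: "continuous_action \<Phi>"
    and absorb: "\<And>\<epsilon>. 0 < \<epsilon> \<Longrightarrow>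
      \<exists>\<eta>>0. \<forall>u x. norm u < \<eta> \<longrightarrow> (\<exists>s. \<bar>s\<bar> \<le> \<epsilon> \<and> \<Phi> u x = \<Phi> (s *\<^sub>R v) x)"
  shows "orbit_topology \<Phi> x = orbit_topology (\<lambda>t. \<Phi> (t *\<^sub>R v)) x"
proof -
  have "\<exists>\<eta>>0. \<forall>u x. norm u < \<eta> \<longrightarrow> (\<exists>s. \<Phi> u x = \<Phi> (s *\<^sub>R v) x)"
    using absorb[of 1] by (meson zero_less_one)
  then have orb: "action_orbit \<Phi> x = action_orbit (\<lambda>t. \<Phi> (t *\<^sub>R v)) x"
    using orbit_eq_line_orbit[OF \<Phi>] by blast
  have "open {u. \<Phi> u x \<in> W}" if W: "open {t::real. \<Phi> (t *\<^sub>R v) x \<in> W}" for W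
    unfolding open_dist
  proof clarify
    fix u assume u: "\<Phi> u x \<in> W"
    obtain s where s: "\<Phi> u x = \<Phi> (s *\<^sub>R v) x"
      using orb unfolding action_orbit_def by (metis (mono_tags, lifting) imageE rangeI)
    then obtain \<epsilon> where \<epsilon>: "0 < \<epsilon>" "cball s \<epsilon> \<subseteq> {t. \<Phi> (t *\<^sub>R v) x \<in> W}"
      using W u open_contains_cball by (metis mem_Collect_eq)
    obtain \<eta> where \<eta>: "0 < \<eta>" "\<And>u x. norm u < \<eta> \<Longrightarrow> \<exists>s. \<bar>s\<bar> \<le> \<epsilon> \<and> \<Phi> u x = \<Phi> (s *\<^sub>R v) x"
      using absorb[OF \<epsilon>(1)] by blast
    have "\<Phi> u' x \<in> W" if u': "dist u' u < \<eta>" for u'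
    proof -
      obtain s' where s': "\<bar>s'\<bar> \<le> \<epsilon>" "\<Phi> (u' - u) (\<Phi> u x) = \<Phi> (s' *\<^sub>R v) (\<Phi> u x)"
        using \<eta>(2)[of "u' - u" "\<Phi> u x"] u' unfolding dist_norm by blast
      have "\<Phi> u' x = \<Phi> (u' - u) (\<Phi> u x)" by (simp flip: continuous_action_add[OF \<Phi>])
      also have "\<dots> = \<Phi> ((s' + s) *\<^sub>R v) x"
        unfolding s' unfolding s by (simp add: scaleR_add_left flip: continuous_action_add[OF \<Phi>])
      finally show ?thesis using \<epsilon>(2) s'(1) by (auto simp: dist_norm subset_iff)
    qed
    with \<eta>(1) show "\<exists>\<eta>>0. \<forall>u'. dist u' u < \<eta> \<longrightarrow> u' \<in> {u. \<Phi> u x \<in> W}" by blast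
  qed
  moreover have "open {t::real. \<Phi> (t *\<^sub>R v) x \<in> W}" if "open {u. \<Phi> u x \<in> W}" for W
  proof -
    have "open ((\<lambda>t::real. t *\<^sub>R v) -` {u. \<Phi> u x \<in> W})"
      using that by (intro open_vimage) (auto intro: continuous_intros)
    then show ?thesis by (simp add: vimage_def)
  qed
  ultimately show ?thesis
    by (auto simp: topology_eq openin_orbit_topology orb)
qed

section \<open>Nontrivial orbits of flows are 1-manifolds\<close>

lemma topspace_orbit_topology: "topspace (orbit_topology \<Phi> x) = action_orbit \<Phi> x"
  using quotient_imp_surjective_map[OF quotient_map_orbit_topology, of \<Phi> x]
  by (simp add: action_orbit_def)

text \<open>The fibres of the orbit map are the cosets of the stabilizer, so the saturation of an open set
  is a union of its translates.\<close>
lemma open_map_orbit_topology: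
  fixes \<Phi> :: "'v::real_normed_vector \<Rightarrow> 'm::topological_space \<Rightarrow> 'm"
  assumes \<Phi>: "continuous_action \<Phi>"
  shows "open_map euclidean (orbit_topology \<Phi> x) (\<lambda>v. \<Phi> v x)"
  unfolding open_map_def
proof clarify
  fix W :: "'v set" assume "openin euclidean W"
  then have W: "open W" by simp
  have "{v. \<Phi> v x \<in> (\<lambda>v. \<Phi> v x) ` W} = (\<Union>p\<in>{p. \<Phi> p x = x}. (+) p ` W)"
  proof (intro set_eqI iffI)
    fix v assume "v \<in> {v. \<Phi> v x \<in> (\<lambda>v. \<Phi> v x) ` W}"
    then obtain w where w: "w \<in> W" "\<Phi> v x = \<Phi> w x" by auto
    have "\<Phi> (v - w) x = \<Phi> (-w) (\<Phi> v x)" by (simp flip: continuous_action_add[OF \<Phi>])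
    also have "\<dots> = x" unfolding w(2)
      by (simp add: continuous_action_zero[OF \<Phi>] flip: continuous_action_add[OF \<Phi>])
    finally show "v \<in> (\<Union>p\<in>{p. \<Phi> p x = x}. (+) p ` W)"
      using w(1) by (auto intro!: exI[of _ "v - w"] image_eqI[of _ _ w])
  next
    fix v assume "v \<in> (\<Union>p\<in>{p. \<Phi> p x = x}. (+) p ` W)"
    then obtain p w where "\<Phi> p x = x" "w \<in> W" "v = w + p" by (auto simp: add.commute)
    then show "v \<in> {v. \<Phi> v x \<in> (\<lambda>v. \<Phi> v x) ` W}"
      by (auto simp: continuous_action_add[OF \<Phi>])
  qed
  also have "open \<dots>" using W by (auto intro: open_translation)
  finally show "openin (orbit_topology \<Phi> x) ((\<lambda>v. \<Phi> v x) ` W)"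
    by (auto simp: openin_orbit_topology action_orbit_def)
qed

text \<open>The orbit topology is finer than the topology induced from the ambient space.\<close>
lemma Hausdorff_orbit_topology:
  fixes \<Phi> :: "'v::real_normed_vector \<Rightarrow> 'm::t2_space \<Rightarrow> 'm"
  assumes \<Phi>: "continuous_action \<Phi>"
  shows "Hausdorff_space (orbit_topology \<Phi> x)"
proof -
  have open_trace: "openin (orbit_topology \<Phi> x) (T \<inter> action_orbit \<Phi> x)" if "open T" for T
  proof -
    have "open ((\<lambda>v. \<Phi> v x) -` T)"
      using that by (intro open_vimage continuous_on_action[OF \<Phi>] continuous_intros)
    then show ?thesis
      by (simp add: openin_orbit_topology vimage_def action_orbit_def)
  qed
  show ?thesis
    unfolding Hausdorff_space_def topspace_orbit_topology
  proof (intro allI impI, elim conjE)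
    fix y z assume yz: "y \<in> action_orbit \<Phi> x" "z \<in> action_orbit \<Phi> x" "y \<noteq> z"
    then obtain P Q where PQ: "open P" "open Q" "y \<in> P" "z \<in> Q" "P \<inter> Q = {}"
      using hausdorff[OF yz(3)] by blast
    show "\<exists>P Q. openin (orbit_topology \<Phi> x) P \<and> openin (orbit_topology \<Phi> x) Q \<and>
        y \<in> P \<and> z \<in> Q \<and> disjnt P Q"
    proof (intro exI conjI)
      show "openin (orbit_topology \<Phi> x) (P \<inter> action_orbit \<Phi> x)"
        "openin (orbit_topology \<Phi> x) (Q \<inter> action_orbit \<Phi> x)"
        using PQ open_trace by blast+
    qed (use yz PQ in \<open>auto simp: disjnt_def\<close>)
  qed
qed

lemma second_countable_orbit_topology:
  fixes \<Phi> :: "'v::euclidean_space \<Rightarrow> 'm::topological_space \<Rightarrow> 'm"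
  assumes \<Phi>: "continuous_action \<Phi>"
  shows "second_countable (orbit_topology \<Phi> x)"
proof (rule second_countable_open_map_image[OF _ open_map_orbit_topology[OF \<Phi>]])
  show "continuous_map euclidean (orbit_topology \<Phi> x) (\<lambda>v. \<Phi> v x)"
    by (rule quotient_imp_continuous_map[OF quotient_map_orbit_topology])
  show "(\<lambda>v. \<Phi> v x) ` topspace euclidean = topspace (orbit_topology \<Phi> x)"
    by (simp add: topspace_orbit_topology action_orbit_def)
  obtain \<B> :: "'v set set" where \<B>: "countable \<B>" "\<And>C. C \<in> \<B> \<Longrightarrow> open C"
      "\<And>S. open S \<Longrightarrow> \<exists>U. U \<subseteq> \<B> \<and> S = \<Union>U"
    using univ_second_countable by metis
  show "second_countable (euclidean :: 'v topology)"
    unfolding second_countable_def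
  proof (intro exI[of _ \<B>] conjI ballI allI impI)
    fix U and v :: 'v assume "openin euclidean U \<and> v \<in> U"
    then show "\<exists>V\<in>\<B>. v \<in> V \<and> V \<subseteq> U" using \<B>(3)[of U] by auto
  qed (use \<B> in auto)
qed

text \<open>The periods of a point form a closed subgroup of the line. If it contained arbitrarily small
  nonzero elements, their multiples would make it dense, hence everything, and the orbit would be a
  point.\<close>
lemma flow_periods_isolated:
  fixes \<phi> :: "real \<Rightarrow> 'm::t2_space \<Rightarrow> 'm"
  assumes \<phi>: "continuous_flow \<phi>" and nontrivial: "action_orbit \<phi> x \<noteq> {x}"
  shows "\<exists>\<epsilon>>0. \<forall>t. \<bar>t\<bar> < \<epsilon> \<longrightarrow> \<phi> t x = x \<longrightarrow> t = 0"
proof (rule ccontr)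
  assume dense: "\<not> ?thesis"
  then have small: "\<exists>s. \<bar>s\<bar> < \<epsilon> \<and> \<phi> s x = x \<and> s \<noteq> 0" if "0 < \<epsilon>" for \<epsilon>
    using that dense by blast
  have nat_multiple: "\<phi> (real n * s) x = x" if "\<phi> s x = x" for s n
  proof (induction n)
    case 0
    show ?case by (simp add: continuous_action_zero[OF \<phi>])
  next
    case (Suc n)
    then show ?case using that by (simp add: algebra_simps continuous_action_add[OF \<phi>])
  qed
  have neg: "\<phi> (- s) x = x" if "\<phi> s x = x" for s
    using continuous_action_add[OF \<phi>, of "-s" s x] that by (simp add: continuous_action_zero[OF \<phi>])
  have int_multiple: "\<phi> (of_int k * s) x = x" if "\<phi> s x = x" for s k
    by (cases k rule: int_cases2) (use nat_multiple[OF that] neg in auto)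
  have "t \<in> closure {t. \<phi> t x = x}" for t
    unfolding closure_approachable
  proof (intro allI impI)
    fix e :: real assume "0 < e"
    then obtain s where s: "\<bar>s\<bar> < e" "\<phi> s x = x" "s \<noteq> 0" using small by blast
    \<comment> \<open>Rounding \<open>t / s\<close> gives a multiple of the period \<open>s\<close> at distance at most \<open>\<bar>s\<bar>\<close> from \<open>t\<close>.\<close>
    have "of_int \<lfloor>t / s\<rfloor> * s - t = s * (of_int \<lfloor>t / s\<rfloor> - t / s)"
      using s(3) by (simp add: right_diff_distrib)
    then have "\<bar>of_int \<lfloor>t / s\<rfloor> * s - t\<bar> = \<bar>s\<bar> * \<bar>of_int \<lfloor>t / s\<rfloor> - t / s\<bar>"
      by (simp only: abs_mult)
    also have "\<dots> \<le> \<bar>s\<bar>"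
      by (rule mult_left_le; linarith)
    finally show "\<exists>y\<in>{t. \<phi> t x = x}. dist y t < e"
      using s(1) int_multiple[OF s(2)] by (intro bexI[of _ "of_int \<lfloor>t / s\<rfloor> * s"]) (auto simp: dist_norm)
  qed
  moreover have "closed {t. \<phi> t x = x}"
    by (intro closed_Collect_eq continuous_on_action[OF \<phi>] continuous_intros)
  ultimately have "\<phi> t x = x" for t by (simp add: closure_closed)
  then show False using nontrivial by (auto simp: action_orbit_def)
qed

lemma homeomorphic_map_real_Euclidean_space_1:
  "homeomorphic_map euclideanreal (Euclidean_space 1) (\<lambda>x i. if i < 1 then x else 0)"
  unfolding homeomorphic_map_maps
proof (intro exI)
  show "homeomorphic_maps euclideanreal (Euclidean_space 1) (\<lambda>x i. if i < 1 then x else 0) (\<lambda>f. f 0)"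
    unfolding homeomorphic_maps_def continuous_map_componentwise_Euclidean_space
    by (auto simp: topspace_Euclidean_space Euclidean_space_def
        intro: continuous_map_from_subtopology continuous_map_product_projection)
qed

text \<open>An interval shorter than every positive period is mapped injectively to the orbit. As the orbit
  map is continuous and open, this gives a chart.\<close>
lemma topological_manifold_flow_orbit:
  fixes \<phi> :: "real \<Rightarrow> 'm::t2_space \<Rightarrow> 'm"
  assumes \<phi>: "continuous_flow \<phi>" and nontrivial: "action_orbit \<phi> x \<noteq> {x}"
  shows "topological_manifold 1 (orbit_topology \<phi> x)"
  unfolding topological_manifold_def topspace_orbit_topology
proof (intro conjI ballI Hausdorff_orbit_topology[OF \<phi>] second_countable_orbit_topology[OF \<phi>])
  let ?X = "orbit_topology \<phi> x" and ?e = "\<lambda>(x::real) (i::nat). if i < 1 then x else 0"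
  fix y assume "y \<in> action_orbit \<phi> x"
  then obtain t0 where t0: "y = \<phi> t0 x" by (auto simp: action_orbit_def)
  obtain \<epsilon> where \<epsilon>: "0 < \<epsilon>" "\<And>t. \<bar>t\<bar> < \<epsilon> \<Longrightarrow> \<phi> t x = x \<Longrightarrow> t = 0"
    using flow_periods_isolated[OF \<phi> nontrivial] by blast
  define I where "I = ball t0 (\<epsilon> / 2)"
  have inj: "inj_on (\<lambda>t. \<phi> t x) I"
  proof (rule inj_onI)
    fix s t assume st: "s \<in> I" "t \<in> I" "\<phi> s x = \<phi> t x"
    have "\<phi> (s - t) x = \<phi> (- t) (\<phi> s x)" by (simp flip: continuous_action_add[OF \<phi>])
    also have "\<dots> = x" unfolding st(3)
      by (simp add: continuous_action_zero[OF \<phi>] flip: continuous_action_add[OF \<phi>])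
    finally show "s = t"
      using \<epsilon>(2)[of "s - t"] st(1,2) unfolding I_def mem_ball dist_real_def by argo
  qed
  define U where "U = (\<lambda>t. \<phi> t x) ` I"
  have openU: "openin ?X U"
    using open_map_orbit_topology[OF \<phi>, of x] by (simp add: open_map_def U_def I_def)
  have "homeomorphic_map (top_of_set I) (subtopology ?X U) (\<lambda>t. \<phi> t x)"
  proof (rule bijective_open_imp_homeomorphic_map)
    show "continuous_map (top_of_set I) (subtopology ?X U) (\<lambda>t. \<phi> t x)"
      using quotient_imp_continuous_map[OF quotient_map_orbit_topology, of \<phi> x]
      by (auto simp: continuous_map_in_subtopology U_def intro: continuous_map_from_subtopology)
    show "open_map (top_of_set I) (subtopology ?X U) (\<lambda>t. \<phi> t x)"
      using open_map_orbit_topology[OF \<phi>, of x]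
      by (auto simp: open_map_def U_def I_def openin_open_subtopology openU[unfolded U_def I_def]
          openin_open_eq)
    show "(\<lambda>t. \<phi> t x) ` topspace (top_of_set I) = topspace (subtopology ?X U)"
      using openin_subset[OF openU] by (auto simp: U_def)
  qed (use inj in simp)
  then have "subtopology ?X U homeomorphic_space top_of_set I"
    using homeomorphic_map_imp_homeomorphic_space homeomorphic_space_sym by blast
  moreover have "homeomorphic_map (top_of_set I) (subtopology (Euclidean_space 1) (?e ` I)) ?e"
    using homeomorphic_map_real_Euclidean_space_1
    by (rule homeomorphic_map_subtopologies)
      (use homeomorphic_imp_surjective_map[OF homeomorphic_map_real_Euclidean_space_1] in auto)
  then have "top_of_set I homeomorphic_space subtopology (Euclidean_space 1) (?e ` I)"
    by (rule homeomorphic_map_imp_homeomorphic_space)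
  moreover have "openin (Euclidean_space 1) (?e ` I)"
    using homeomorphic_imp_open_map[OF homeomorphic_map_real_Euclidean_space_1]
    by (simp add: open_map_def I_def)
  moreover have "y \<in> U" using \<epsilon>(1) by (auto simp: U_def I_def t0)
  ultimately show "\<exists>U V. openin ?X U \<and> y \<in> U \<and> openin (Euclidean_space 1) V \<and>
      subtopology ?X U homeomorphic_space subtopology (Euclidean_space 1) V"
    using openU homeomorphic_space_trans by blast
qed

theorem corollary2p2:
  fixes A :: "('m::{t2_space, second_countable_topology}, 'n::finite) chart set"
    and g :: "('m, 'n) chart \<Rightarrow> real ^ 'n \<Rightarrow> real ^ 'n \<Rightarrow> real ^ 'n \<Rightarrow> real"
    and \<Phi> :: "real ^ 'd \<Rightarrow> 'm \<Rightarrow> 'm"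
  assumes "compact (UNIV :: 'm set)"
    and "smooth_atlas A"
    and "riemannian_metric A g"
    and "continuous_action \<Phi>"
    and "\<exists>v. komuro_expansive (riemannian_dist A g) (\<lambda>t. \<Phi> (t *\<^sub>R v))"
  shows "(\<forall>x. action_orbit \<Phi> x \<noteq> {x} \<longrightarrow> topological_manifold 1 (orbit_topology \<Phi> x)) \<and>
    (\<exists>\<psi>. continuous_flow \<psi> \<and> (\<forall>x. action_orbit \<Phi> x = action_orbit \<psi> x))"
proof -
  obtain v where v: "komuro_expansive (riemannian_dist A g) (\<lambda>t. \<Phi> (t *\<^sub>R v))"
    using assms(5) by blast
  have absorb: "\<exists>\<eta>>0. \<forall>u x. norm u < \<eta> \<longrightarrow> (\<exists>s. \<bar>s\<bar> \<le> \<epsilon> \<and> \<Phi> u x = \<Phi> (s *\<^sub>R v) x)"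
    if "0 < \<epsilon>" for \<epsilon>
    using expansive_line_absorbs_small_vectors[OF assms(1-4) v that] by metis
  have top: "orbit_topology \<Phi> x = orbit_topology (\<lambda>t. \<Phi> (t *\<^sub>R v)) x" for x
    by (rule orbit_topology_eq_line_orbit_topology[OF assms(4) absorb])
  then have orb: "action_orbit \<Phi> x = action_orbit (\<lambda>t. \<Phi> (t *\<^sub>R v)) x" for x
    by (metis topspace_orbit_topology)
  have flow: "continuous_flow (\<lambda>t. \<Phi> (t *\<^sub>R v))"
    by (rule continuous_action_line[OF assms(4)])
  show ?thesis
  proof (intro conjI allI impI)
    fix x assume "action_orbit \<Phi> x \<noteq> {x}"
    then show "topological_manifold 1 (orbit_topology \<Phi> x)"
      using topological_manifold_flow_orbit[OF flow] by (simp add: top orb)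
  qed (use flow orb in blast)
qed

end
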